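(* There exists an absolute constant $C$ such that, for any integers $s\ge1$ and $d\ge3$ satisfying $s\le\sqrt d$, and any $\kappa,\sigma>0$, $$\sup_{\theta\in B_2(\kappa)\cap B_0(s)} \mathbf E_\theta\big(\tilde Q - Q(\theta)\big)^2 \le C\max\big\{\sigma^2\kappa^2,\ \sigma^4s^2\log^2d\big\}.$$
   Context: Model: one observes $y_j=\theta_j+\sigma\xi_j$, $j=1,\dots,d$, where $\theta=(\theta_1,\dots,\theta_d)\in\mathbb R^d$ is unknown, $\xi_1,\dots,\xi_d$ are i.i.d. standard normal and $\sigma>0$. $\mathbf P_\theta$ is the law of $(y_1,\dots,y_d)$ and $\mathbf E_\theta$ the corresponding expectation. $Q(\theta)=\sum_{i=1}^d\theta_i^2$; $\|\theta\|_2=\sqrt{Q(\theta)}$; $\|\theta\|_0$ is the number of non-zero components of $\theta$; $B_0(s)=\{\theta\in\mathbb R^d:\|\theta\|_0\le s\}$; $B_2(\kappa)=\{\theta\in\mathbb R^d:\|\theta\|_2\le\kappa\}$. Let $y_{(1)}^2\le\dots\le y_{(d)}^2$ be the order statistics of $y_1^2,\dots,y_d^2$ and set $$\hat\sigma=3\Big(\frac1d\sum_{j\le d-\sqrt d}y_{(j)}^2\Big)^{1/2},\qquad \tilde Q=\sum_{j=1}^d y_j^2\,\mathbf 1_{\{|y_j|>\hat\sigma\sqrt{2\log d}\}}.$$ *)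

theory Defs
  imports "HOL-Probability.Probability"
begin

text \<open>
  The constant in the risk bound must not depend on the dimension \<open>d\<close>, so \<open>d\<close> has to be an ordinary
  variable: \<open>d\<close>-dimensional Euclidean space is the set of extensional functions on \<open>{1..d}\<close>, the
  carrier of the product measure spaces over \<open>{1..d}\<close>.
\<close>

definition euclid :: "nat \<Rightarrow> (nat \<Rightarrow> real) set" where
  "euclid d = ({1..d} \<rightarrow>\<^sub>E UNIV)"

definition Q_fun :: "nat \<Rightarrow> (nat \<Rightarrow> real) \<Rightarrow> real" where
  "Q_fun d \<theta> = (\<Sum>i=1..d. (\<theta> i)\<^sup>2)"

definition norm2 :: "nat \<Rightarrow> (nat \<Rightarrow> real) \<Rightarrow> real" where
  "norm2 d \<theta> = sqrt (Q_fun d \<theta>)"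

definition norm0 :: "nat \<Rightarrow> (nat \<Rightarrow> real) \<Rightarrow> nat" where
  "norm0 d \<theta> = card {i \<in> {1..d}. \<theta> i \<noteq> 0}"

definition B0 :: "nat \<Rightarrow> nat \<Rightarrow> (nat \<Rightarrow> real) set" where
  "B0 d s = {\<theta> \<in> euclid d. norm0 d \<theta> \<le> s}"

definition B2 :: "nat \<Rightarrow> real \<Rightarrow> (nat \<Rightarrow> real) set" where
  "B2 d \<kappa> = {\<theta> \<in> euclid d. norm2 d \<theta> \<le> \<kappa>}"

definition noise_law :: "nat \<Rightarrow> (nat \<Rightarrow> real) measure" where
  "noise_law d = (\<Pi>\<^sub>M j\<in>{1..d}. density lborel (\<lambda>x. ennreal (std_normal_density x)))"

definition obs_law :: "nat \<Rightarrow> real \<Rightarrow> (nat \<Rightarrow> real) \<Rightarrow> (nat \<Rightarrow> real) measure" where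
  "obs_law d \<sigma> \<theta> =
     distr (noise_law d) (\<Pi>\<^sub>M j\<in>{1..d}. borel) (\<lambda>\<xi>. \<lambda>j\<in>{1..d}. \<theta> j + \<sigma> * \<xi> j)"

text \<open>The order statistics are numbered from 1, list positions from 0.\<close>

definition order_stat_sq :: "nat \<Rightarrow> (nat \<Rightarrow> real) \<Rightarrow> nat \<Rightarrow> real" where
  "order_stat_sq d y j = sort (map (\<lambda>i. (y i)\<^sup>2) [1..<Suc d]) ! (j - 1)"

definition sigma_hat :: "nat \<Rightarrow> (nat \<Rightarrow> real) \<Rightarrow> real" where
  "sigma_hat d y =
     3 * sqrt (1 / real d *
       (\<Sum>j | j \<in> {1..d} \<and> real j \<le> real d - sqrt (real d). order_stat_sq d y j))"

definition Q_tilde :: "nat \<Rightarrow> (nat \<Rightarrow> real) \<Rightarrow> real" where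
  "Q_tilde d y =
     (\<Sum>j=1..d. (y j)\<^sup>2 *
        (if \<bar>y j\<bar> > sigma_hat d y * sqrt (2 * ln (real d)) then 1 else 0))"

text \<open>
  The risk is an expectation of a nonnegative variable, taken in \<open>[0, \<infinity>]\<close>: a finite upper bound
  then includes integrability, whereas a non-integrable function has Bochner integral \<open>0\<close>.
\<close>

definition mse :: "nat \<Rightarrow> real \<Rightarrow> (nat \<Rightarrow> real) \<Rightarrow> ennreal" where
  "mse d \<sigma> \<theta> = (\<integral>\<^sup>+ y. ennreal ((Q_tilde d y - Q_fun d \<theta>)\<^sup>2) \<partial>obs_law d \<sigma> \<theta>)"

end

theory Submission
  imports Defs "HOL-Real_Asymp.Real_Asymp"
begin

text \<open>
  Write \<open>y = \<theta> + \<sigma> \<xi>\<close> with standard Gaussian noise \<open>\<xi>\<close>. At least \<open>d - \<surd>d\<close> coordinates carry pure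
  noise, so the trimmed sum is at most \<open>\<sigma>\<^sup>2\<close> times the sum of all \<open>\<xi>\<^sub>i\<^sup>2\<close>; this makes the bias from
  thresholding the support of order \<open>\<sigma>\<^sup>2 s ln d\<close>. The rest of the error on the support is the
  linear term \<open>2 \<sigma> \<Sum> \<theta>\<^sub>i \<xi>\<^sub>i\<close>, of variance at most \<open>4 \<sigma>\<^sup>2 \<kappa>\<^sup>2\<close>, and \<open>\<sigma>\<^sup>2\<close> times the sum of \<open>\<xi>\<^sub>i\<^sup>2\<close> over
  the support. Off the support, if the estimated noise level is at least \<open>\<sigma>\<close>, only coordinates with
  \<open>\<bar>\<xi>\<^sub>i\<bar> > \<surd>(2 ln d)\<close> survive, and Gaussian tails bound their contribution. The noise level is
  underestimated only if far too many observations are small, an event whose indicator is dominated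
  by an exponential weight that factorizes over the coordinates; its expectation decays
  geometrically in \<open>d\<close> and beats the trivial bound \<open>d\<^sup>2\<close> for the squared error. Since the dominating
  function depends on \<open>\<xi>\<close> only, the measurability of the order statistics is never needed.
\<close>

section \<open>Sums of the smallest order statistics\<close>

lemma sum_nth_sort:
  fixes f :: "'a::linorder \<Rightarrow> 'b::comm_monoid_add"
  shows "(\<Sum>i<length xs. f (sort xs ! i)) = sum_list (map f xs)"
proof -
  have "(\<Sum>i<length xs. f (sort xs ! i)) = sum_list (map f (sort xs))"
    by (simp add: sum_list_sum_nth atLeast0LessThan)
  also have "\<dots> = sum_list (map f xs)"
    by (metis mset_map mset_sort sum_mset_sum_list)
  finally show ?thesis .
qed

text \<open>Counts and sums of positive parts are symmetric in the entries, so with this identity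
  the next two bounds need no explicit sorting permutation.\<close>

lemma sum_nth_sort_upt:
  fixes x :: "nat \<Rightarrow> 'a::linorder" and f :: "'a \<Rightarrow> 'b::comm_monoid_add"
  shows "(\<Sum>i<d. f (sort (map x [1..<Suc d]) ! i)) = (\<Sum>i=1..d. f (x i))"
  using sum_nth_sort[of f "map x [1..<Suc d]"]
  by (simp add: sum_list_distinct_conv_sum_set atLeastLessThanSuc_atLeastAtMost o_def del: upt_Suc)

text \<open>With \<open>v\<close> the \<open>m\<close>-th smallest value, the positive parts of
  \<open>v - x i\<close> over all indices sum to exactly \<open>m * v\<close> minus the sum of the
  \<open>m\<close> smallest entries, and this dominates the sum of \<open>v - x i\<close> over
  \<open>A\<close>.\<close>

lemma sum_smallest_le:
  fixes x :: "nat \<Rightarrow> real"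
  assumes A: "A \<subseteq> {1..d}" and m: "card A = m"
  shows "(\<Sum>i<m. sort (map x [1..<Suc d]) ! i) \<le> (\<Sum>i\<in>A. x i)"
proof (cases "m = 0")
  case True
  then have "A = {}" using m finite_subset[OF A] by simp
  then show ?thesis using True by simp
next
  case False
  define xs where "xs = sort (map x [1..<Suc d])"
  define v where "v = xs ! (m - 1)"
  have md: "m \<le> d" using card_mono[OF finite_atLeastAtMost A] m by simp
  have len: "length xs = d" by (simp add: xs_def)
  have mono: "xs ! i \<le> xs ! j" if "i \<le> j" "j < d" for i j
  proof -
    have "sorted xs" by (simp only: xs_def sorted_sort)
    then show ?thesis using that len by (intro sorted_nth_mono) simp_all
  qed
  have "(\<Sum>i\<in>A. v - x i) \<le> (\<Sum>i\<in>A. max 0 (v - x i))"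
    by (intro sum_mono) simp
  also have "\<dots> \<le> (\<Sum>i=1..d. max 0 (v - x i))"
    using A by (intro sum_mono2) auto
  also have "\<dots> = (\<Sum>i<d. max 0 (v - xs ! i))"
    unfolding xs_def using sum_nth_sort_upt[of "\<lambda>u. max 0 (v - u)" x d] by simp
  also have "\<dots> = (\<Sum>i<m. max 0 (v - xs ! i))"
  proof (intro sum.mono_neutral_right ballI)
    fix i assume "i \<in> {..<d} - {..<m}"
    then have "v \<le> xs ! i" unfolding v_def by (intro mono) auto
    then show "max 0 (v - xs ! i) = 0" by simp
  qed (use md in auto)
  also have "\<dots> = (\<Sum>i<m. v - xs ! i)"
  proof (intro sum.cong refl)
    fix i assume "i \<in> {..<m}"
    then have "xs ! i \<le> v" unfolding v_def using md by (intro mono) auto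
    then show "max 0 (v - xs ! i) = v - xs ! i" by simp
  qed
  finally show ?thesis
    using m by (simp add: sum_subtractf xs_def)
qed

text \<open>Among the \<open>m\<close> smallest entries, at most as many as the cardinality on the
  left are \<open>\<le> \<tau>\<close>; each of the others exceeds \<open>\<tau>\<close>, and the
  small ones contribute at least 0.\<close>

lemma sum_smallest_ge:
  fixes x :: "nat \<Rightarrow> real"
  assumes "m \<le> d" and x: "\<And>i. i \<in> {1..d} \<Longrightarrow> 0 \<le> x i" and "0 \<le> \<tau>"
  shows "\<tau> * (real m - real (card {i \<in> {1..d}. x i \<le> \<tau>}))
    \<le> (\<Sum>i<m. sort (map x [1..<Suc d]) ! i)"
proof -
  define xs where "xs = sort (map x [1..<Suc d])"
  have nn: "0 \<le> xs ! i" if "i < d" for i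
  proof -
    have "xs ! i \<in> set xs" using that by (intro nth_mem) (simp add: xs_def)
    then show ?thesis using x by (auto simp: xs_def simp del: upt_Suc)
  qed
  have "real (card {i \<in> {1..d}. x i \<le> \<tau>}) = (\<Sum>i=1..d. if x i \<le> \<tau> then 1 else 0)"
    by (simp add: sum.If_cases Int_def)
  also have "\<dots> = (\<Sum>i<d. if xs ! i \<le> \<tau> then 1 else 0)"
    unfolding xs_def using sum_nth_sort_upt[of "\<lambda>u. if u \<le> \<tau> then 1 else 0::real" x d] by simp
  also have "\<dots> \<ge> (\<Sum>i<m. if xs ! i \<le> \<tau> then 1 else 0)"
    using assms by (intro sum_mono2) auto
  finally have "(\<Sum>i<m. if xs ! i \<le> \<tau> then 1 else 0) \<le> real (card {i \<in> {1..d}. x i \<le> \<tau>})" .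
  then have "\<tau> * (real m - real (card {i \<in> {1..d}. x i \<le> \<tau>}))
      \<le> \<tau> * (real m - (\<Sum>i<m. if xs ! i \<le> \<tau> then 1 else 0))"
    using assms by (intro mult_left_mono) auto
  also have "\<dots> = (\<Sum>i<m. \<tau> * (1 - (if xs ! i \<le> \<tau> then 1 else 0)))"
    by (simp add: sum_distrib_left[symmetric] sum_subtractf)
  also have "\<dots> \<le> (\<Sum>i<m. xs ! i)"
    using nn assms by (intro sum_mono) (auto simp: less_imp_le)
  finally show ?thesis by (simp add: xs_def)
qed

lemma trimmed_sum_eq:
  defines "m \<equiv> \<lambda>d. nat \<lfloor>real d - sqrt (real d)\<rfloor>"
  shows "(\<Sum>j | j \<in> {1..d} \<and> real j \<le> real d - sqrt (real d). order_stat_sq d y j)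
    = (\<Sum>i<m d. sort (map (\<lambda>i. (y i)\<^sup>2) [1..<Suc d]) ! i)"
proof -
  have eq: "{j. j \<in> {1..d} \<and> real j \<le> real d - sqrt (real d)} = {1..m d}"
  proof (intro set_eqI iffI)
    fix j assume "j \<in> {j. j \<in> {1..d} \<and> real j \<le> real d - sqrt (real d)}"
    then show "j \<in> {1..m d}" unfolding m_def by (auto simp: le_nat_floor)
  next
    fix j assume j: "j \<in> {1..m d}"
    \<comment> \<open>A positive value of \<open>nat\<close> rules out truncation of a negative
      floor, so the floor itself bounds \<open>j\<close>.\<close>
    then have "0 < m d" "j \<le> m d" by auto
    then have "real j \<le> real d - sqrt (real d)" unfolding m_def by linarith
    moreover from this have "real j \<le> real d" using real_sqrt_ge_zero[of "real d"] by linarith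
    ultimately show "j \<in> {j. j \<in> {1..d} \<and> real j \<le> real d - sqrt (real d)}" using j by auto
  qed
  show ?thesis unfolding eq order_stat_sq_def
    by (rule sum.reindex_bij_witness[where i=Suc and j="\<lambda>j. j - 1"]) auto
qed

section \<open>Gaussian moments and the noise law\<close>

abbreviation gauss :: "real measure" where
  "gauss \<equiv> density lborel (\<lambda>x. ennreal (std_normal_density x))"

interpretation gauss: prob_space gauss
  using prob_space_normal_density[of 1 0] by simp

interpretation gauss_prod: product_prob_space "\<lambda>_::nat. gauss" UNIV
  by unfold_locales

lemma emeasure_gauss_UNIV: "emeasure gauss UNIV = 1"
  using gauss.emeasure_space_1 by simp

lemma nn_integral_gauss:
  assumes [measurable]: "f \<in> borel_measurable borel"
  shows "(\<integral>\<^sup>+x. f x \<partial>gauss) = (\<integral>\<^sup>+x. ennreal (std_normal_density x) * f x \<partial>lborel)"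
  by (subst nn_integral_density) auto

lemma nn_integral_gauss_fourth_moment: "(\<integral>\<^sup>+x. ennreal (x ^ 4) \<partial>gauss) = 3"
proof -
  \<comment> \<open>The moment of order \<open>2 * k\<close> is
    \<open>fact (2 * k) / (2 ^ k * fact k)\<close>, which is 24 / 8 = 3 for
    \<open>k = 2\<close>.\<close>
  have hb: "has_bochner_integral lborel (\<lambda>x. std_normal_density x * x ^ 4) 3"
    using std_normal_moment_even[of 2] by (simp add: fact_numeral)
  have "(\<integral>\<^sup>+x. ennreal (x ^ 4) \<partial>gauss) = (\<integral>\<^sup>+x. ennreal (std_normal_density x * x ^ 4) \<partial>lborel)"
    by (subst nn_integral_gauss) (auto simp: ennreal_mult)
  also have "\<dots> = ennreal 3"
    using hb by (subst nn_integral_eq_integral) (auto simp: has_bochner_integral_iff)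
  finally show ?thesis by simp
qed

text \<open>The shift \<open>x = c (t + u)\<close> gains the factor \<open>exp (- t\<^sup>2 / 2)\<close> because \<open>t u \<ge> 0\<close>.\<close>

lemma nn_integral_gauss_half_tail:
  assumes t: "0 \<le> t" and c: "c = 1 \<or> c = (-1::real)"
  shows "(\<integral>\<^sup>+x. ennreal (x ^ 4 * indicator {t<..} (c * x)) \<partial>gauss)
    \<le> ennreal (8 * (t ^ 4 + 3) * exp (- t\<^sup>2 / 2))"
proof -
  have cc: "c * c = 1" "\<bar>c\<bar> = 1" "c\<^sup>2 = 1" "c ^ 4 = 1" using c by auto
  \<comment> \<open>The sign \<open>c\<close> treats both tails at once. For
    \<open>u \<le> 0\<close> the indicator vanishes after the shift, so only \<open>u > 0\<close>
    needs an estimate.\<close>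
  have le: "std_normal_density (c * t + c * u) * ((c * t + c * u) ^ 4 * indicator {t<..} (c * (c * t + c * u)))
      \<le> 8 * exp (- t\<^sup>2 / 2) * (t ^ 4 * std_normal_density u + std_normal_density u * u ^ 4)" for u
  proof (cases "u > 0")
    case False
    then have "c * (c * t + c * u) \<le> t" using cc by (simp add: algebra_simps flip: mult.assoc)
    then show ?thesis by simp
  next
    case True
    have "(c * t + c * u)\<^sup>2 = (t + u)\<^sup>2"
      using cc by (metis distrib_left mult_1 power_mult_distrib)
    moreover have "(t + u)\<^sup>2 \<ge> t\<^sup>2 + u\<^sup>2" using True t by (simp add: power2_sum)
    ultimately have "std_normal_density (c * t + c * u) \<le> exp (- t\<^sup>2 / 2) * std_normal_density u"
      by (simp add: std_normal_density_def divide_right_mono flip: exp_add)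
    moreover have "(c * t + c * u) ^ 4 \<le> 8 * (t ^ 4 + u ^ 4)"
    proof -
      have "(c * t + c * u) ^ 4 = (t + u) ^ 4"
        using cc by (metis distrib_left mult_1 power_mult_distrib)
      \<comment> \<open>Two applications of
        \<open>(a + b)\<^sup>2 \<le> 2 * (a\<^sup>2 + b\<^sup>2)\<close> produce the constant
        8.\<close>
      also have "\<dots> = ((t + u)\<^sup>2)\<^sup>2" by simp
      also have "\<dots> \<le> (2 * (t\<^sup>2 + u\<^sup>2))\<^sup>2"
        by (intro power_mono) (use sum_squares_bound[of t u] t True in \<open>auto simp: power2_sum\<close>)
      also have "\<dots> \<le> 8 * (t ^ 4 + u ^ 4)"
        using sum_squares_bound[of "t\<^sup>2" "u\<^sup>2"] by (simp add: power2_eq_square power4_eq_xxxx algebra_simps)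
      finally show ?thesis .
    qed
    ultimately have "std_normal_density (c * t + c * u) * (c * t + c * u) ^ 4
        \<le> (exp (- t\<^sup>2 / 2) * std_normal_density u) * (8 * (t ^ 4 + u ^ 4))"
      by (intro mult_mono) auto
    moreover have "std_normal_density (c * t + c * u) * ((c * t + c * u) ^ 4 * indicator {t<..} (c * (c * t + c * u)))
        \<le> std_normal_density (c * t + c * u) * (c * t + c * u) ^ 4"
      by (auto simp: indicator_def)
    ultimately show ?thesis by (simp add: algebra_simps)
  qed
  \<comment> \<open>The majorant is integrated over the whole line, where the total mass is 1 and
    the fourth moment is 3.\<close>
  have hb: "has_bochner_integral lborel
      (\<lambda>u. 8 * exp (- t\<^sup>2 / 2) * (t ^ 4 * std_normal_density u + std_normal_density u * u ^ 4))
      (8 * exp (- t\<^sup>2 / 2) * (t ^ 4 * 1 + 3))"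
    using std_normal_moment_even[of 0] std_normal_moment_even[of 2]
    by (intro has_bochner_integral_mult_right has_bochner_integral_add) (simp_all add: fact_numeral)
  have "(\<integral>\<^sup>+x. ennreal (x ^ 4 * indicator {t<..} (c * x)) \<partial>gauss)
      = (\<integral>\<^sup>+x. ennreal (std_normal_density x * (x ^ 4 * indicator {t<..} (c * x))) \<partial>lborel)"
    by (subst nn_integral_gauss) (auto simp: ennreal_mult)
  also have "\<dots> = (\<integral>\<^sup>+u. ennreal (std_normal_density (c * t + c * u) *
      ((c * t + c * u) ^ 4 * indicator {t<..} (c * (c * t + c * u)))) \<partial>lborel)"
    using c by (subst nn_integral_real_affine[where c=c and t="c * t"]) auto
  also have "\<dots> \<le> (\<integral>\<^sup>+u. ennreal (8 * exp (- t\<^sup>2 / 2) *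
      (t ^ 4 * std_normal_density u + std_normal_density u * u ^ 4)) \<partial>lborel)"
    by (intro nn_integral_mono ennreal_leI le)
  also have "\<dots> = ennreal (8 * exp (- t\<^sup>2 / 2) * (t ^ 4 * 1 + 3))"
    using hb by (subst nn_integral_eq_integral) (auto simp: has_bochner_integral_iff)
  finally show ?thesis by (simp add: algebra_simps)
qed

lemma nn_integral_gauss_tail:
  assumes t: "0 \<le> t"
  shows "(\<integral>\<^sup>+x. ennreal (x ^ 4 * indicator {t<..} \<bar>x\<bar>) \<partial>gauss)
    \<le> ennreal (16 * (t ^ 4 + 3) * exp (- t\<^sup>2 / 2))"
proof -
  have "(\<integral>\<^sup>+x. ennreal (x ^ 4 * indicator {t<..} \<bar>x\<bar>) \<partial>gauss)
      \<le> (\<integral>\<^sup>+x. ennreal (x ^ 4 * indicator {t<..} (1 * x)) + ennreal (x ^ 4 * indicator {t<..} (- 1 * x)) \<partial>gauss)"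
    by (intro nn_integral_mono) (auto simp: indicator_def abs_if simp flip: ennreal_plus)
  also have "\<dots> = (\<integral>\<^sup>+x. ennreal (x ^ 4 * indicator {t<..} (1 * x)) \<partial>gauss)
      + (\<integral>\<^sup>+x. ennreal (x ^ 4 * indicator {t<..} (- 1 * x)) \<partial>gauss)"
    by (intro nn_integral_add) auto
  also have "\<dots> \<le> ennreal (8 * (t ^ 4 + 3) * exp (- t\<^sup>2 / 2)) + ennreal (8 * (t ^ 4 + 3) * exp (- t\<^sup>2 / 2))"
    by (intro add_mono nn_integral_gauss_half_tail t) auto
  also have "\<dots> = ennreal (16 * (t ^ 4 + 3) * exp (- t\<^sup>2 / 2))"
    by (subst ennreal_plus[symmetric]) (auto simp: algebra_simps)
  finally show ?thesis .
qed

text \<open>The density is at most 1/2 and the event is an interval of length \<open>2 * h\<close>.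
  The bound is uniform in the shift \<open>a\<close>, so it also serves coordinates with nonzero
  mean.\<close>

lemma nn_integral_gauss_indicator_interval:
  assumes "0 \<le> h"
  shows "(\<integral>\<^sup>+x. ennreal (indicator {..h} \<bar>a + x\<bar>) \<partial>gauss) \<le> ennreal h"
proof -
  have dens: "std_normal_density x \<le> 1 / 2" for x :: real
  proof -
    have "sqrt (2 * pi) \<ge> 2" using pi_ge_two by (intro real_le_rsqrt) auto
    then have "1 / sqrt (2 * pi) \<le> 1 / 2" by (intro divide_left_mono) auto
    moreover have "exp (- x\<^sup>2 / 2) \<le> 1" by simp
    ultimately have "1 / sqrt (2 * pi) * exp (- x\<^sup>2 / 2) \<le> 1 / 2 * 1" by (intro mult_mono) auto
    then show ?thesis by (simp add: std_normal_density_def)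
  qed
  have "(\<integral>\<^sup>+x. ennreal (indicator {..h} \<bar>a + x\<bar>) \<partial>gauss)
      = (\<integral>\<^sup>+x. ennreal (std_normal_density x * indicator {..h} \<bar>a + x\<bar>) \<partial>lborel)"
    by (subst nn_integral_gauss) (auto simp: ennreal_mult)
  also have "\<dots> \<le> (\<integral>\<^sup>+x. ennreal (1 / 2) * indicator {- a - h..- a + h} x \<partial>lborel)"
    proof (intro nn_integral_mono)
    fix x :: real
    have "std_normal_density x * indicator {..h} \<bar>a + x\<bar> \<le> 1 / 2 * indicator {- a - h..- a + h} x"
      using dens[of x] by (auto simp: indicator_def)
    then show "ennreal (std_normal_density x * indicator {..h} \<bar>a + x\<bar>)
        \<le> ennreal (1 / 2) * indicator {- a - h..- a + h} x"
      using ennreal_leI[OF dens[of x]] by (auto simp: indicator_def)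
  qed
  also have "\<dots> = ennreal (1 / 2) * ennreal (2 * h)"
    using assms by (subst nn_integral_cmult_indicator) auto
  also have "\<dots> = ennreal h" using assms by (subst ennreal_mult[symmetric]) auto
  finally show ?thesis .
qed

section \<open>Integration against the product law of the noise\<close>

lemma nn_integral_noise_prod:
  assumes "\<And>i. i \<in> {1..d} \<Longrightarrow> f i \<in> borel_measurable borel"
  shows "(\<integral>\<^sup>+\<xi>. (\<Prod>i=1..d. f i (\<xi> i)) \<partial>noise_law d) = (\<Prod>i=1..d. \<integral>\<^sup>+x. f i x \<partial>gauss)"
  unfolding noise_law_def using assms by (intro gauss_prod.product_nn_integral_prod) auto

lemma measurable_noise_coord [measurable]:
  "i \<in> {1..d} \<Longrightarrow> (\<lambda>\<xi>. \<xi> i) \<in> borel_measurable (noise_law d)"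
  unfolding noise_law_def by (rule measurable_PiM_component_rev) auto

lemma nn_integral_noise_pair:
  assumes [measurable]: "f \<in> borel_measurable borel" "g \<in> borel_measurable borel"
    and ij: "i \<in> {1..d}" "j \<in> {1..d}" "i \<noteq> j"
  shows "(\<integral>\<^sup>+\<xi>. f (\<xi> i) * g (\<xi> j) \<partial>noise_law d) = (\<integral>\<^sup>+x. f x \<partial>gauss) * (\<integral>\<^sup>+x. g x \<partial>gauss)"
proof -
  \<comment> \<open>Factors equal to 1 at the other coordinates complete the integrand to a full
    product, and they integrate to 1.\<close>
  let ?h = "\<lambda>k x. (if k = i then f x else 1) * (if k = j then g x else 1)"
  have "(\<integral>\<^sup>+\<xi>. f (\<xi> i) * g (\<xi> j) \<partial>noise_law d) = (\<integral>\<^sup>+\<xi>. (\<Prod>k=1..d. ?h k (\<xi> k)) \<partial>noise_law d)"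
    using ij by (simp add: prod.distrib)
  also have "\<dots> = (\<Prod>k=1..d. \<integral>\<^sup>+x. ?h k x \<partial>gauss)"
    by (intro nn_integral_noise_prod) auto
  also have "\<dots> = (\<Prod>k=1..d. (if k = i then \<integral>\<^sup>+x. f x \<partial>gauss else 1) * (if k = j then \<integral>\<^sup>+x. g x \<partial>gauss else 1))"
    using ij by (intro prod.cong) (auto simp: emeasure_gauss_UNIV)
  also have "\<dots> = (\<integral>\<^sup>+x. f x \<partial>gauss) * (\<integral>\<^sup>+x. g x \<partial>gauss)"
    using ij by (simp add: prod.distrib)
  finally show ?thesis .
qed

lemma nn_integral_noise_coord:
  assumes [measurable]: "f \<in> borel_measurable borel" and i: "i \<in> {1..d}"
  shows "(\<integral>\<^sup>+\<xi>. f (\<xi> i) \<partial>noise_law d) = (\<integral>\<^sup>+x. f x \<partial>gauss)"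
proof -
  have "(\<integral>\<^sup>+\<xi>. f (\<xi> i) \<partial>noise_law d)
      = (\<integral>\<^sup>+\<xi>. (\<Prod>k=1..d. if k = i then f (\<xi> k) else 1) \<partial>noise_law d)"
    using i by simp
  also have "\<dots> = (\<Prod>k=1..d. \<integral>\<^sup>+x. (if k = i then f x else 1) \<partial>gauss)"
    by (intro nn_integral_noise_prod) auto
  also have "\<dots> = (\<Prod>k=1..d. if k = i then \<integral>\<^sup>+x. f x \<partial>gauss else 1)"
    by (intro prod.cong) (auto simp: emeasure_gauss_UNIV)
  also have "\<dots> = (\<integral>\<^sup>+x. f x \<partial>gauss)"
    using i by simp
  finally show ?thesis .
qed

text \<open>Cauchy-Schwarz bounds the square by \<open>card A\<close> times the sum of the fourth
  powers, each of expectation 3. This serves both the support of \<open>\<theta>\<close> and the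
  full set of coordinates.\<close>

lemma nn_integral_noise_sq_norm:
  assumes A: "A \<subseteq> {1..d}"
  shows "(\<integral>\<^sup>+\<xi>. ennreal ((\<Sum>i\<in>A. (\<xi> i)\<^sup>2)\<^sup>2) \<partial>noise_law d) \<le> ennreal (3 * (real (card A))\<^sup>2)"
proof -
  have fin: "finite A" using A finite_subset by blast
  have [measurable]: "(\<lambda>\<xi>. \<xi> i) \<in> borel_measurable (noise_law d)" if "i \<in> A" for i
    using that A by (auto intro!: measurable_noise_coord)
  have "(\<integral>\<^sup>+\<xi>. ennreal ((\<Sum>i\<in>A. (\<xi> i)\<^sup>2)\<^sup>2) \<partial>noise_law d)
      \<le> (\<integral>\<^sup>+\<xi>. (\<Sum>i\<in>A. ennreal (card A) * ennreal ((\<xi> i) ^ 4)) \<partial>noise_law d)"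
  proof (intro nn_integral_mono)
    fix \<xi> :: "nat \<Rightarrow> real"
    have "(\<Sum>i\<in>A. (\<xi> i)\<^sup>2)\<^sup>2 \<le> card A * (\<Sum>i\<in>A. ((\<xi> i)\<^sup>2)\<^sup>2)"
      using sum_squared_le_sum_of_squares[of "\<lambda>i. (\<xi> i)\<^sup>2" A] by (simp add: mult.commute)
    also have "\<dots> = (\<Sum>i\<in>A. card A * (\<xi> i) ^ 4)"
      by (simp add: sum_distrib_left)
    finally show "ennreal ((\<Sum>i\<in>A. (\<xi> i)\<^sup>2)\<^sup>2) \<le> (\<Sum>i\<in>A. ennreal (card A) * ennreal ((\<xi> i) ^ 4))"
      by (simp add: ennreal_leI flip: ennreal_mult)
  qed
  also have "\<dots> = (\<Sum>i\<in>A. ennreal (card A) * (\<integral>\<^sup>+\<xi>. ennreal ((\<xi> i) ^ 4) \<partial>noise_law d))"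
    by (subst nn_integral_sum) (auto simp: nn_integral_cmult)
  also have "\<dots> = (\<Sum>i\<in>A. ennreal (card A) * 3)"
    using A by (intro sum.cong refl)
      (auto simp: nn_integral_noise_coord[where f="\<lambda>x. ennreal (x ^ 4)"] nn_integral_gauss_fourth_moment)
  also have "\<dots> = ennreal (3 * (real (card A))\<^sup>2)"
    by (simp add: power2_eq_square ennreal_mult ennreal_of_nat_eq_real_of_nat mult_ac)
  finally show ?thesis .
qed

text \<open>The integrand changes sign, hence the Bochner integral. For \<open>i \<noteq> j\<close>
  two factors of the product are centred; for \<open>i = j\<close> one factor is a second
  moment.\<close>

lemma has_bochner_integral_noise_cov:
  assumes ij: "i \<in> {1..d}" "j \<in> {1..d}"
  shows "has_bochner_integral (noise_law d) (\<lambda>\<xi>. \<xi> i * \<xi> j) (if i = j then 1 else 0)"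
proof -
  have m: "has_bochner_integral gauss (\<lambda>x. x) 0" "has_bochner_integral gauss (\<lambda>x. x * x) 1"
      "has_bochner_integral gauss (\<lambda>x. 1::real) 1"
    using std_normal_moment_odd[of 0] std_normal_moment_even[of 1] std_normal_moment_even[of 0]
    by (auto intro!: has_bochner_integral_density simp: power2_eq_square)
  let ?h = "\<lambda>k x. (if k = i then x else 1) * (if k = j then x else 1 :: real)"
  have hb: "has_bochner_integral gauss (?h k)
      (if k = i \<and> k = j then 1 else if k = i \<or> k = j then 0 else 1)" for k
    using m by auto
  have eq: "(\<Prod>k=1..d. ?h k (\<xi> k)) = \<xi> i * \<xi> j" for \<xi>
    using ij by (simp add: prod.distrib)
  have "integrable (noise_law d) (\<lambda>\<xi>. \<Prod>k=1..d. ?h k (\<xi> k))"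
    unfolding noise_law_def using hb
    by (intro gauss_prod.product_integrable_prod) (auto simp: has_bochner_integral_iff)
  moreover have "(\<integral>\<xi>. (\<Prod>k=1..d. ?h k (\<xi> k)) \<partial>noise_law d) = (\<Prod>k=1..d. integral\<^sup>L gauss (?h k))"
    unfolding noise_law_def using hb
    by (intro gauss_prod.product_integral_prod) (auto simp: has_bochner_integral_iff)
  moreover have "(\<Prod>k=1..d. integral\<^sup>L gauss (?h k)) =
      (\<Prod>k=1..d. if k = i \<and> k = j then 1 else if k = i \<or> k = j then 0 else 1)"
    by (intro prod.cong refl has_bochner_integral_integral_eq hb)
  moreover have "\<dots> = (if i = j then 1 else 0 :: real)"
  proof (cases "i = j")
    case True
    then show ?thesis by (intro trans[OF prod.neutral]) auto
  next
    case False
    then show ?thesis using ij by (intro trans[OF prod_zero]) (auto intro!: bexI[of _ i])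
  qed
  ultimately show ?thesis unfolding has_bochner_integral_iff eq by simp
qed

text \<open>The coordinates are orthonormal, so the cross terms cancel. Applying Cauchy-Schwarz to
  the coordinates in the support instead would cost a factor \<open>s\<close> in front of
  \<open>\<sigma>\<^sup>2 * \<kappa>\<^sup>2\<close>.\<close>

lemma nn_integral_noise_linear:
  "(\<integral>\<^sup>+\<xi>. ennreal ((\<Sum>i=1..d. a i * \<xi> i)\<^sup>2) \<partial>noise_law d) = ennreal (\<Sum>i=1..d. (a i)\<^sup>2)"
proof -
  have "has_bochner_integral (noise_law d)
      (\<lambda>\<xi>. \<Sum>i=1..d. \<Sum>j=1..d. a i * a j * (\<xi> i * \<xi> j))
      (\<Sum>i=1..d. \<Sum>j=1..d. a i * a j * (if i = j then 1 else 0))"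
    by (intro has_bochner_integral_sum has_bochner_integral_mult_right has_bochner_integral_noise_cov)
  moreover have "(\<Sum>i=1..d. a i * \<xi> i)\<^sup>2 = (\<Sum>i=1..d. \<Sum>j=1..d. a i * a j * (\<xi> i * \<xi> j))" for \<xi>
    by (simp add: power2_eq_square sum_product mult_ac)
  moreover have "(\<Sum>i=1..d. \<Sum>j=1..d. a i * a j * (if i = j then 1 else 0)) = (\<Sum>i=1..d. (a i)\<^sup>2)"
    by (simp add: power2_eq_square if_distrib cong: if_cong)
  ultimately have "has_bochner_integral (noise_law d) (\<lambda>\<xi>. (\<Sum>i=1..d. a i * \<xi> i)\<^sup>2) (\<Sum>i=1..d. (a i)\<^sup>2)"
    by simp
  then show ?thesis
    by (subst nn_integral_eq_integral) (auto simp: has_bochner_integral_iff)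
qed

text \<open>Holds because \<open>exp 1 \<le> 3\<close>; it lets additive constants be absorbed into
  powers of \<open>ln (real d)\<close>.\<close>

lemma ln_ge_one: "d \<ge> 3 \<Longrightarrow> 1 \<le> ln (real d)"
  using exp_le by (subst ln_ge_iff) auto

text \<open>The threshold is chosen so that \<open>exp (- t\<^sup>2 / 2) = 1 / d\<close>. A summand
  then has first moment of order \<open>L / d\<close> and second moment of order
  \<open>L\<^sup>2 / d\<close>; the \<open>d\<close> diagonal and \<open>d\<^sup>2\<close> product
  terms give 112 + 56 * 56 = 3248.\<close>

lemma nn_integral_noise_thresholded:
  assumes d: "d \<ge> 3"
  defines "t \<equiv> sqrt (2 * ln (real d))"
  shows "(\<integral>\<^sup>+\<xi>. ennreal ((\<Sum>i=1..d. (\<xi> i)\<^sup>2 * indicator {t<..} \<bar>\<xi> i\<bar>)\<^sup>2) \<partial>noise_law d)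
    \<le> ennreal (3248 * (ln (real d))\<^sup>2)"
proof -
  define L where "L = ln (real d)"
  define W where "W = (\<lambda>x::real. x\<^sup>2 * indicator {t<..} \<bar>x\<bar>)"
  have L: "1 \<le> L" unfolding L_def by (rule ln_ge_one[OF d])
  have t0: "0 < t" and t2: "t\<^sup>2 = 2 * L" using L by (auto simp: t_def L_def)
  have [measurable]: "W \<in> borel_measurable borel" unfolding W_def by measurable
  have mW: "(\<lambda>\<xi>. ennreal (W (\<xi> i))) \<in> borel_measurable (noise_law d)" if "i \<in> {1..d}" for i
    using measurable_noise_coord[OF that] by measurable
  have W0: "0 \<le> W x" for x by (simp add: W_def)
  have W2: "(W x)\<^sup>2 = x ^ 4 * indicator {t<..} \<bar>x\<bar>" for x
    by (simp add: W_def indicator_def)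
  \<comment> \<open>The tail bound contributes 16 * (4 + 3) = 112, with the additive 3 absorbed by
    \<open>1 \<le> L\<^sup>2\<close>.\<close>
  have E2: "(\<integral>\<^sup>+x. ennreal ((W x)\<^sup>2) \<partial>gauss) \<le> ennreal (112 * L\<^sup>2 / d)"
  proof -
    have "t ^ 4 = 4 * L\<^sup>2" using power_mult[of t 2 2] by (simp add: t2 power_mult_distrib)
    moreover have "exp (- t\<^sup>2 / 2) = 1 / d" using d by (simp add: t2 L_def exp_minus inverse_eq_divide)
    moreover have "1 \<le> L\<^sup>2" using L by simp
    then have "16 * (4 * L\<^sup>2 + 3) * (1 / real d) \<le> (112 * L\<^sup>2) * (1 / real d)"
      by (intro mult_right_mono) auto
    ultimately have "16 * (t ^ 4 + 3) * exp (- t\<^sup>2 / 2) \<le> 112 * L\<^sup>2 / d" by simp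
    with nn_integral_gauss_tail[OF less_imp_le[OF t0]] show ?thesis
      unfolding W2 by (rule order_trans[OF _ ennreal_leI])
  qed
  have E1: "(\<integral>\<^sup>+x. ennreal (W x) \<partial>gauss) \<le> ennreal (56 * L / d)"
  proof -
    \<comment> \<open>A nonzero value of \<open>W\<close> exceeds \<open>t\<^sup>2 = 2 * L\<close>,
      so the first moment is at most the second divided by \<open>2 * L\<close>.\<close>
    have "W x \<le> 1 / t\<^sup>2 * (W x)\<^sup>2" for x
    proof (cases "t < \<bar>x\<bar>")
      case True
      then have "t\<^sup>2 \<le> \<bar>x\<bar>\<^sup>2" using t0 by (intro power_mono) auto
      then have "W x * t\<^sup>2 \<le> W x * x\<^sup>2" using W0 by (intro mult_left_mono) auto
      also have "\<dots> = (W x)\<^sup>2" using True by (simp add: W_def power2_eq_square)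
      finally show ?thesis using t0 by (simp add: field_simps)
    qed (simp add: W_def)
    then have "(\<integral>\<^sup>+x. ennreal (W x) \<partial>gauss) \<le> (\<integral>\<^sup>+x. ennreal (1 / t\<^sup>2) * ennreal ((W x)\<^sup>2) \<partial>gauss)"
      by (intro nn_integral_mono) (simp add: ennreal_leI flip: ennreal_mult)
    also have "\<dots> \<le> ennreal (1 / t\<^sup>2) * ennreal (112 * L\<^sup>2 / d)"
      by (subst nn_integral_cmult) (auto intro!: mult_left_mono E2)
    also have "\<dots> = ennreal (56 * L / d)"
      unfolding t2 using L by (subst ennreal_mult[symmetric]) (auto simp: power2_eq_square)
    finally show ?thesis .
  qed
  \<comment> \<open>The product term is also granted to the diagonal, so that the double sum
    separates.\<close>
  have pair: "(\<integral>\<^sup>+\<xi>. ennreal (W (\<xi> i)) * ennreal (W (\<xi> j)) \<partial>noise_law d)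
      \<le> ennreal ((if i = j then 112 * L\<^sup>2 / d else 0) + (56 * L / d)\<^sup>2)"
    if ij: "i \<in> {1..d}" "j \<in> {1..d}" for i j
  proof (cases "i = j")
    case True
    have "(\<integral>\<^sup>+\<xi>. ennreal (W (\<xi> i)) * ennreal (W (\<xi> j)) \<partial>noise_law d)
        = (\<integral>\<^sup>+\<xi>. ennreal ((W (\<xi> i))\<^sup>2) \<partial>noise_law d)"
      using True W0 by (simp add: power2_eq_square ennreal_mult)
    also have "\<dots> = (\<integral>\<^sup>+x. ennreal ((W x)\<^sup>2) \<partial>gauss)"
      using ij by (intro nn_integral_noise_coord[where f="\<lambda>x. ennreal ((W x)\<^sup>2)"]) auto
    also have "\<dots> \<le> ennreal (112 * L\<^sup>2 / d)" by (rule E2)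
    also have "\<dots> \<le> ennreal ((if i = j then 112 * L\<^sup>2 / d else 0) + (56 * L / d)\<^sup>2)"
      using True by (intro ennreal_leI) simp
    finally show ?thesis .
  next
    case False
    have "(\<integral>\<^sup>+\<xi>. ennreal (W (\<xi> i)) * ennreal (W (\<xi> j)) \<partial>noise_law d)
        = (\<integral>\<^sup>+x. ennreal (W x) \<partial>gauss) * (\<integral>\<^sup>+x. ennreal (W x) \<partial>gauss)"
      using ij False by (intro nn_integral_noise_pair[where f="\<lambda>x. ennreal (W x)" and g="\<lambda>x. ennreal (W x)"]) auto
    also have "\<dots> \<le> ennreal (56 * L / d) * ennreal (56 * L / d)"
      by (intro mult_mono E1) auto
    also have "\<dots> = ennreal ((if i = j then 112 * L\<^sup>2 / d else 0) + (56 * L / d)\<^sup>2)"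
      using False L by (simp add: power2_eq_square flip: ennreal_mult)
    finally show ?thesis .
  qed
  have "(\<integral>\<^sup>+\<xi>. ennreal ((\<Sum>i=1..d. W (\<xi> i))\<^sup>2) \<partial>noise_law d)
      = (\<integral>\<^sup>+\<xi>. (\<Sum>i=1..d. \<Sum>j=1..d. ennreal (W (\<xi> i)) * ennreal (W (\<xi> j))) \<partial>noise_law d)"
    using W0 by (simp add: power2_eq_square sum_product sum_nonneg flip: ennreal_mult)
  also have "\<dots> = (\<Sum>i=1..d. \<integral>\<^sup>+\<xi>. (\<Sum>j=1..d. ennreal (W (\<xi> i)) * ennreal (W (\<xi> j))) \<partial>noise_law d)"
    by (intro nn_integral_sum borel_measurable_sum borel_measurable_times_ennreal mW)
  also have "\<dots> = (\<Sum>i=1..d. \<Sum>j=1..d. \<integral>\<^sup>+\<xi>. ennreal (W (\<xi> i)) * ennreal (W (\<xi> j)) \<partial>noise_law d)"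
    by (intro sum.cong refl nn_integral_sum borel_measurable_times_ennreal mW)
  also have "\<dots> \<le> (\<Sum>i=1..d. \<Sum>j=1..d. ennreal ((if i = j then 112 * L\<^sup>2 / d else 0) + (56 * L / d)\<^sup>2))"
    by (intro sum_mono pair)
  also have "\<dots> = ennreal (\<Sum>i=1..d. \<Sum>j=1..d. (if i = j then 112 * L\<^sup>2 / d else 0) + (56 * L / d)\<^sup>2)"
    by (simp add: sum_nonneg del: ennreal_plus)
  also have "(\<Sum>i=1..d. \<Sum>j=1..d. (if i = j then 112 * L\<^sup>2 / d else 0) + (56 * L / d)\<^sup>2) = 3248 * L\<^sup>2"
    using d by (simp add: sum.distrib power2_eq_square)
  finally show ?thesis by (simp add: W_def L_def)
qed

text \<open>After Cauchy-Schwarz each term carries a single fourth power, at coordinate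
  \<open>j\<close>. There the weight is bounded by \<open>l\<close> and the fourth moment is 3; by
  independence every other coordinate contributes at most \<open>\<rho>\<close>.\<close>

lemma nn_integral_noise_weighted:
  fixes g :: "nat \<Rightarrow> real \<Rightarrow> real"
  assumes [measurable]: "\<And>i. g i \<in> borel_measurable borel"
    and g0: "\<And>i x. 0 \<le> g i x" and gl: "\<And>i x. g i x \<le> l"
    and E: "\<And>i. (\<integral>\<^sup>+x. ennreal (g i x) \<partial>gauss) \<le> ennreal \<rho>" and \<rho>: "1 \<le> \<rho>"
  shows "(\<integral>\<^sup>+\<xi>. ennreal ((\<Sum>i=1..d. (\<xi> i)\<^sup>2)\<^sup>2 * (\<Prod>i=1..d. g i (\<xi> i))) \<partial>noise_law d)
    \<le> ennreal (3 * l * (real d)\<^sup>2 * \<rho> ^ d)"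
proof -
  have l0: "0 \<le> l" using g0 gl order_trans by blast
  let ?h = "\<lambda>j i x. ennreal ((if i = j then x ^ 4 else 1) * g i x)"
  have coord: "(\<integral>\<^sup>+\<xi>. (\<Prod>i=1..d. ?h j i (\<xi> i)) \<partial>noise_law d) \<le> ennreal (3 * l * \<rho> ^ d)"
    if j: "j \<in> {1..d}" for j
  proof -
    have at_j: "(\<integral>\<^sup>+x. ?h j j x \<partial>gauss) \<le> ennreal (3 * l)"
    proof -
      have "(\<integral>\<^sup>+x. ?h j j x \<partial>gauss) \<le> (\<integral>\<^sup>+x. ennreal l * ennreal (x ^ 4) \<partial>gauss)"
      proof (intro nn_integral_mono)
        fix x :: real
        have "x ^ 4 * g j x \<le> l * x ^ 4" using mult_right_mono[OF gl[of j x], of "x ^ 4"] by (simp add: mult.commute)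
        then show "?h j j x \<le> ennreal l * ennreal (x ^ 4)"
          using l0 by (simp add: ennreal_leI flip: ennreal_mult)
      qed
      also have "\<dots> = ennreal (3 * l)"
        using l0 by (simp add: nn_integral_cmult nn_integral_gauss_fourth_moment ennreal_mult mult.commute)
      finally show ?thesis .
    qed
    have "(\<integral>\<^sup>+\<xi>. (\<Prod>i=1..d. ?h j i (\<xi> i)) \<partial>noise_law d) = (\<Prod>i=1..d. \<integral>\<^sup>+x. ?h j i x \<partial>gauss)"
      by (intro nn_integral_noise_prod) measurable
    also have "\<dots> = (\<integral>\<^sup>+x. ?h j j x \<partial>gauss) * (\<Prod>i\<in>{1..d} - {j}. \<integral>\<^sup>+x. ?h j i x \<partial>gauss)"
      using j by (intro prod.remove) auto
    also have "\<dots> \<le> ennreal (3 * l) * (\<Prod>i\<in>{1..d} - {j}. ennreal \<rho>)"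
    proof (intro mult_mono at_j prod_mono_ennreal)
      fix i assume "i \<in> {1..d} - {j}"
      then show "(\<integral>\<^sup>+x. ?h j i x \<partial>gauss) \<le> ennreal \<rho>" using E[of i] by simp
    qed auto
    also have "\<dots> = ennreal (3 * l * \<rho> ^ (d - 1))"
      using j l0 \<rho> by (simp add: ennreal_mult ennreal_power)
    \<comment> \<open>Since \<open>\<rho> \<ge> 1\<close>, the factor missing at coordinate
      \<open>j\<close> may be restored.\<close>
    also have "\<dots> \<le> ennreal (3 * l * \<rho> ^ d)"
      using l0 \<rho> by (intro ennreal_leI mult_left_mono power_increasing) auto
    finally show ?thesis .
  qed
  have "(\<integral>\<^sup>+\<xi>. ennreal ((\<Sum>i=1..d. (\<xi> i)\<^sup>2)\<^sup>2 * (\<Prod>i=1..d. g i (\<xi> i))) \<partial>noise_law d)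
      \<le> (\<integral>\<^sup>+\<xi>. (\<Sum>j=1..d. ennreal d * (\<Prod>i=1..d. ?h j i (\<xi> i))) \<partial>noise_law d)"
  proof (intro nn_integral_mono)
    fix \<xi> :: "nat \<Rightarrow> real"
    let ?P = "\<Prod>i=1..d. g i (\<xi> i)"
    have P0: "0 \<le> ?P" using g0 by (intro prod_nonneg) auto
    have "(\<Sum>i=1..d. (\<xi> i)\<^sup>2)\<^sup>2 \<le> real d * (\<Sum>i=1..d. (\<xi> i) ^ 4)"
      using sum_squared_le_sum_of_squares[of "\<lambda>i. (\<xi> i)\<^sup>2" "{1..d}"] by (simp add: mult.commute)
    then have "(\<Sum>i=1..d. (\<xi> i)\<^sup>2)\<^sup>2 * ?P \<le> real d * (\<Sum>i=1..d. (\<xi> i) ^ 4) * ?P"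
      using P0 by (rule mult_right_mono)
    also have "\<dots> = (\<Sum>j=1..d. real d * ((\<xi> j) ^ 4 * ?P))"
      by (simp add: sum_distrib_left sum_distrib_right mult.assoc)
    also have "\<dots> = (\<Sum>j=1..d. real d * (\<Prod>i=1..d. (if i = j then (\<xi> i) ^ 4 else 1) * g i (\<xi> i)))"
      by (intro sum.cong refl) (simp add: prod.distrib)
    finally have "ennreal ((\<Sum>i=1..d. (\<xi> i)\<^sup>2)\<^sup>2 * ?P)
        \<le> ennreal (\<Sum>j=1..d. real d * (\<Prod>i=1..d. (if i = j then (\<xi> i) ^ 4 else 1) * g i (\<xi> i)))"
      by (rule ennreal_leI)
    also have "\<dots> = (\<Sum>j=1..d. ennreal d * (\<Prod>i=1..d. ?h j i (\<xi> i)))"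
      using g0 by (subst sum_ennreal[symmetric])
        (auto simp: prod_ennreal ennreal_mult[symmetric] prod_nonneg simp del: sum_ennreal)
    finally show "ennreal ((\<Sum>i=1..d. (\<xi> i)\<^sup>2)\<^sup>2 * ?P) \<le> (\<Sum>j=1..d. ennreal d * (\<Prod>i=1..d. ?h j i (\<xi> i)))" .
  qed
  also have "\<dots> = (\<Sum>j=1..d. ennreal d * (\<integral>\<^sup>+\<xi>. (\<Prod>i=1..d. ?h j i (\<xi> i)) \<partial>noise_law d))"
    by (subst nn_integral_sum) (auto intro!: sum.cong nn_integral_cmult borel_measurable_prod_ennreal)
  also have "\<dots> \<le> (\<Sum>j=1..d. ennreal d * ennreal (3 * l * \<rho> ^ d))"
    by (intro sum_mono mult_left_mono coord) auto
  also have "\<dots> = ennreal (3 * l * (real d)\<^sup>2 * \<rho> ^ d)"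
    using l0 \<rho> by (simp add: power2_eq_square ennreal_of_nat_eq_real_of_nat mult_ac flip: ennreal_mult)
  finally show ?thesis .
qed

section \<open>Pointwise bound on the error\<close>

text \<open>Both \<open>sqrt (real d)\<close> and the rounding loss, which is below 1, are at most
  \<open>real d / 100\<close>.\<close>

lemma trim_count_ge:
  assumes "real d \<ge> 10000"
  shows "real (nat \<lfloor>real d - sqrt (real d)\<rfloor>) \<ge> 98 / 100 * real d"
proof -
  have "sqrt (real d) \<le> real d / 100"
  proof (rule real_le_lsqrt)
    have "10000 * real d \<le> real d * real d" using assms by (intro mult_right_mono) auto
    then show "real d \<le> (real d / 100)\<^sup>2" by (simp add: power2_eq_square)
  qed simp_all
  then show ?thesis using assms by linarith
qed

text \<open>At least 98/100 - 2/3 = 47/150 of the \<open>d\<close> observations enter the trimmed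
  sum with a square above \<open>9 / 25 * \<sigma>\<^sup>2\<close>. With the factor 3 of the
  estimator squared, 9 * (9/25) * (47/150) = 1.0152, just above 1.\<close>

lemma sigma_hat_ge:
  assumes d: "real d \<ge> 10000" and \<sigma>: "\<sigma> > 0"
    and N: "3 * card {i \<in> {1..d}. (y i)\<^sup>2 \<le> 9 / 25 * \<sigma>\<^sup>2} \<le> 2 * d"
  shows "\<sigma> \<le> sigma_hat d y"
proof -
  let ?m = "nat \<lfloor>real d - sqrt (real d)\<rfloor>"
  let ?N = "card {i \<in> {1..d}. (y i)\<^sup>2 \<le> 9 / 25 * \<sigma>\<^sup>2}"
  define S where "S = (\<Sum>j | j \<in> {1..d} \<and> real j \<le> real d - sqrt (real d). order_stat_sq d y j)"
  have md: "?m \<le> d" using real_sqrt_ge_zero[of "real d"] by linarith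
  have "real ?N \<le> 2 / 3 * real d" using N by linarith
  with trim_count_ge[OF d] have "real ?m - real ?N \<ge> 47 / 150 * real d" by argo
  then have "9 / 25 * \<sigma>\<^sup>2 * (47 / 150 * real d) \<le> 9 / 25 * \<sigma>\<^sup>2 * (real ?m - real ?N)"
    by (intro mult_left_mono) auto
  also have "\<dots> \<le> S"
    unfolding S_def trimmed_sum_eq by (intro sum_smallest_ge md) auto
  finally have "\<sigma>\<^sup>2 * real d \<le> 9 * S"
    using mult_nonneg_nonneg[of "\<sigma>\<^sup>2" "real d"] by (simp only: zero_le_power2 of_nat_0_le_iff) argo
  then have "(\<sigma> / 3)\<^sup>2 \<le> 1 / real d * S"
    using d by (simp add: field_simps power2_eq_square)
  then have "\<sigma> / 3 \<le> sqrt (1 / real d * S)" by (rule real_le_rsqrt)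
  then show ?thesis by (simp add: sigma_hat_def S_def)
qed

text \<open>
  Exponential Markov weight: underestimating the noise level forces more than two thirds of the
  observations into \<open>[- 3 \<sigma> / 5, 3 \<sigma> / 5]\<close>, unless \<open>d < 10000\<close>, which the constant \<open>K\<close> absorbs.
  Here \<open>1331 / 1000 = (11 / 10) ^ 3\<close> and \<open>121 / 100 = (11 / 10) ^ 2\<close>.
\<close>

lemma sigma_hat_small_weight:
  "\<exists>K>0::real. \<forall>d y \<sigma>. \<sigma> > 0 \<longrightarrow> sigma_hat d y < \<sigma> \<longrightarrow>
    1 \<le> K * (100 / 121) ^ d * (\<Prod>i=1..d. 1 + 331 / 1000 * indicator {..3 / 5} \<bar>y i / \<sigma>\<bar>)"
proof -
  define D :: nat where "D = 10000"
  define K :: real where "K = (121 / 100) ^ D"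
  have K: "1 \<le> K" unfolding K_def by (intro one_le_power) simp
  have "1 \<le> K * (100 / 121) ^ d * (\<Prod>i=1..d. 1 + 331 / 1000 * indicator {..3 / 5} \<bar>y i / \<sigma>\<bar>)"
    if \<sigma>: "\<sigma> > 0" and small: "sigma_hat d y < \<sigma>" for d y \<sigma>
  proof -
    define N where "N = card {i \<in> {1..d}. (y i)\<^sup>2 \<le> 9 / 25 * \<sigma>\<^sup>2}"
    have iff: "\<bar>y i / \<sigma>\<bar> \<le> 3 / 5 \<longleftrightarrow> (y i)\<^sup>2 \<le> 9 / 25 * \<sigma>\<^sup>2" for i
    proof -
      have "\<bar>y i / \<sigma>\<bar> \<le> 3 / 5 \<longleftrightarrow> \<bar>y i\<bar> \<le> \<bar>3 / 5 * \<sigma>\<bar>"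
        using \<sigma> by (simp add: field_simps abs_mult)
      also have "\<dots> \<longleftrightarrow> (y i)\<^sup>2 \<le> (3 / 5 * \<sigma>)\<^sup>2" by (rule abs_le_square_iff)
      finally show ?thesis by (simp add: power_mult_distrib power_divide)
    qed
    have "(\<Prod>i=1..d. 1 + 331 / 1000 * indicator {..3 / 5} \<bar>y i / \<sigma>\<bar>)
        = (\<Prod>i=1..d. if (y i)\<^sup>2 \<le> 9 / 25 * \<sigma>\<^sup>2 then 1331 / 1000 else 1 :: real)"
      unfolding indicator_def atMost_iff iff by (intro prod.cong refl) simp
    also have "\<dots> = (1331 / 1000) ^ N"
      by (simp add: prod.If_cases N_def Int_def)
    also have "\<dots> = (11 / 10) ^ (3 * N)" by (simp add: power_mult power3_eq_cube)
    finally have prod: "(\<Prod>i=1..d. 1 + 331 / 1000 * indicator {..3 / 5} \<bar>y i / \<sigma>\<bar>) = (11 / 10 :: real) ^ (3 * N)" .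
    have two: "(121 / 100 :: real) ^ d = (11 / 10) ^ (2 * d)" by (simp add: power_mult power2_eq_square)
    have "(121 / 100) ^ d \<le> K * (11 / 10) ^ (3 * N)"
    proof (cases "2 * d \<le> 3 * N")
      case True
      then have "(11 / 10 :: real) ^ (2 * d) \<le> (11 / 10) ^ (3 * N)" by (intro power_increasing) auto
      also have "\<dots> \<le> K * (11 / 10) ^ (3 * N)" using K mult_right_mono[OF K, of "(11 / 10) ^ (3 * N)"] by simp
      finally show ?thesis by (simp add: two)
    next
      case False
      then have "d < D" using sigma_hat_ge[of d \<sigma> y] \<sigma> small by (auto simp: N_def D_def not_le[symmetric])
      then have "(121 / 100) ^ d \<le> K" unfolding K_def by (intro power_increasing) auto
      also have "\<dots> \<le> K * (11 / 10) ^ (3 * N)"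
        using K mult_left_mono[of 1 "(11 / 10) ^ (3 * N)" K] by simp
      finally show ?thesis .
    qed
    then have "(100 / 121) ^ d * (121 / 100) ^ d \<le> (100 / 121) ^ d * (K * (11 / 10) ^ (3 * N))"
      by (intro mult_left_mono) auto
    then show ?thesis
      unfolding prod by (simp add: mult_ac flip: power_mult_distrib)
  qed
  with K show ?thesis by (intro exI[of _ K]) auto
qed

section \<open>Decomposition of the error\<close>

lemma sq_sum_four_le: "(a + b - c + e)\<^sup>2 \<le> 4 * (a\<^sup>2 + b\<^sup>2 + c\<^sup>2 + e\<^sup>2)" for a b c e :: real
proof -
  \<comment> \<open>The difference of the two sides is the sum of squared pairwise differences of
    \<open>a\<close>, \<open>b\<close>, \<open>- c\<close>, \<open>e\<close>.\<close>
  have "0 \<le> (a - b)\<^sup>2 + (a + c)\<^sup>2 + (a - e)\<^sup>2 + (b + c)\<^sup>2 + (b - e)\<^sup>2 + (c + e)\<^sup>2"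
    by (intro add_nonneg_nonneg) auto
  then show ?thesis by (simp add: power2_eq_square algebra_simps)
qed

text \<open>
  The parameter \<open>w\<close> stands for any majorant of the indicator of underestimating the noise level.
\<close>

lemma Q_tilde_error_le:
  fixes \<theta> \<xi> y :: "nat \<Rightarrow> real"
  assumes d: "d \<ge> 3" and s: "real s \<le> sqrt (real d)" and \<theta>: "norm0 d \<theta> \<le> s" and \<sigma>: "\<sigma> > 0"
    and y: "\<And>i. i \<in> {1..d} \<Longrightarrow> y i = \<theta> i + \<sigma> * \<xi> i"
    and w: "sigma_hat d y < \<sigma> \<Longrightarrow> 1 \<le> w" and w0: "0 \<le> w"
  defines "L \<equiv> ln (real d)" and "X \<equiv> (\<Sum>i=1..d. (\<xi> i)\<^sup>2)" and "A \<equiv> {i \<in> {1..d}. \<theta> i \<noteq> 0}"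
  shows "(Q_tilde d y - Q_fun d \<theta>)\<^sup>2 \<le> 4 * (4 * \<sigma>\<^sup>2 * (\<Sum>i=1..d. \<theta> i * \<xi> i)\<^sup>2
    + \<sigma> ^ 4 * (\<Sum>i\<in>A. (\<xi> i)\<^sup>2)\<^sup>2 + \<sigma> ^ 4 * (real s * 18 * L / real d)\<^sup>2 * X\<^sup>2
    + (\<sigma> ^ 4 * (\<Sum>i=1..d. (\<xi> i)\<^sup>2 * indicator {sqrt (2 * L)<..} \<bar>\<xi> i\<bar>)\<^sup>2 + \<sigma> ^ 4 * (X\<^sup>2 * w)))"
proof -
  define T where "T = sigma_hat d y * sqrt (2 * ln (real d))"
  define S where "S = (\<Sum>j | j \<in> {1..d} \<and> real j \<le> real d - sqrt (real d). order_stat_sq d y j)"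
  define I where "I = (\<lambda>i. if \<bar>y i\<bar> > T then 1 else 0 :: real)"
  define B where "B = {1..d} - A"
  \<comment> \<open>\<open>R\<close> is what the threshold removes on the support of
    \<open>\<theta>\<close>, \<open>Z\<close> what survives off it.\<close>
  define R where "R = (\<Sum>i\<in>A. (y i)\<^sup>2 * (1 - I i))"
  define Z where "Z = (\<Sum>i\<in>B. (y i)\<^sup>2 * I i)"
  have L0: "0 \<le> L" using d by (simp add: L_def)
  have X0: "0 \<le> X" by (simp add: X_def sum_nonneg)
  have fin: "finite A" "finite B" and AB: "A \<union> B = {1..d}" "A \<inter> B = {}" "A \<subseteq> {1..d}" "B \<subseteq> {1..d}"
    by (auto simp: A_def B_def)
  have cA: "card A \<le> s" using \<theta> by (simp add: A_def norm0_def)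
  have yB: "y i = \<sigma> * \<xi> i" if "i \<in> B" for i using that y by (auto simp: B_def A_def)
  have split: "sum f {1..d} = sum f A + sum f B" for f :: "nat \<Rightarrow> real"
    using AB fin by (metis sum.union_disjoint)
  have S_le: "S \<le> \<sigma>\<^sup>2 * X"
  proof -
    let ?m = "nat \<lfloor>real d - sqrt (real d)\<rfloor>"
    \<comment> \<open>The hypothesis \<open>s \<le> sqrt d\<close> enters here: there are at least
      as many pure noise coordinates as trimmed summands, so the smallest squares can be compared
      with squares of pure noise.\<close>
    have "card B = d - card A" unfolding B_def using AB fin by (simp add: card_Diff_subset)
    moreover have "real ?m \<le> real d - sqrt (real d)"
    proof -
      have "sqrt (real d) \<le> real d" using d by (intro real_le_lsqrt) (auto simp: power2_eq_square)
      then show ?thesis by linarith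
    qed
    ultimately have "?m \<le> card B" using cA s by linarith
    then obtain M where M: "M \<subseteq> B" "card M = ?m" using obtain_subset_with_card_n by metis
    have "S \<le> (\<Sum>i\<in>M. (y i)\<^sup>2)"
      unfolding S_def trimmed_sum_eq using M AB by (intro sum_smallest_le) auto
    also have "\<dots> \<le> (\<Sum>i\<in>B. (y i)\<^sup>2)" using M fin by (intro sum_mono2) auto
    also have "\<dots> = (\<Sum>i\<in>B. \<sigma>\<^sup>2 * (\<xi> i)\<^sup>2)" by (intro sum.cong refl) (simp add: yB power_mult_distrib)
    also have "\<dots> \<le> (\<Sum>i=1..d. \<sigma>\<^sup>2 * (\<xi> i)\<^sup>2)" using AB by (intro sum_mono2) auto
    finally show ?thesis by (simp add: X_def sum_distrib_left)
  qed
  have S0: "0 \<le> S"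
  proof -
    have "nat \<lfloor>real d - sqrt (real d)\<rfloor> \<le> d" using real_sqrt_ge_zero[of "real d"] by linarith
    from sum_smallest_ge[OF this, of "\<lambda>i. (y i)\<^sup>2" 0] show ?thesis
      unfolding S_def trimmed_sum_eq by simp
  qed
  have hat0: "0 \<le> sigma_hat d y" using S0 by (simp add: sigma_hat_def S_def)
  have T0: "0 \<le> T" using hat0 L0 by (simp add: T_def L_def)
  have T2: "T\<^sup>2 \<le> \<sigma>\<^sup>2 * (18 * L / d * X)"
  proof -
    \<comment> \<open>18 is the squared factor 3 of the estimator times the 2 inside the
      threshold.\<close>
    have "T\<^sup>2 = 18 * L / d * S"
      unfolding T_def sigma_hat_def S_def[symmetric] L_def[symmetric]
      using S0 L0 by (simp add: power_mult_distrib)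
    also have "\<dots> \<le> 18 * L / d * (\<sigma>\<^sup>2 * X)" using S_le L0 by (intro mult_left_mono) auto
    finally show ?thesis by (simp add: mult_ac)
  qed
  have "Q_tilde d y - Q_fun d \<theta> = (\<Sum>i\<in>A. (y i)\<^sup>2 * I i - (\<theta> i)\<^sup>2) + Z"
  proof -
    have "(\<Sum>i\<in>B. (\<theta> i)\<^sup>2) = 0" by (simp add: A_def B_def)
    moreover have "Q_tilde d y = (\<Sum>i=1..d. (y i)\<^sup>2 * I i)"
      unfolding Q_tilde_def T_def[symmetric] I_def ..
    ultimately show ?thesis unfolding Q_fun_def split sum_subtractf Z_def by simp
  qed
  \<comment> \<open>On the support, \<open>y\<^sup>2 * I - \<theta>\<^sup>2\<close> is split as
    \<open>(y\<^sup>2 - \<theta>\<^sup>2) - y\<^sup>2 * (1 - I)\<close>.\<close>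
  also have "(\<Sum>i\<in>A. (y i)\<^sup>2 * I i - (\<theta> i)\<^sup>2)
      = (\<Sum>i\<in>A. 2 * \<sigma> * (\<theta> i * \<xi> i) + \<sigma>\<^sup>2 * (\<xi> i)\<^sup>2 - (y i)\<^sup>2 * (1 - I i))"
  proof (intro sum.cong refl)
    fix i assume "i \<in> A"
    then have "y i = \<theta> i + \<sigma> * \<xi> i" using AB y by auto
    then have "(y i)\<^sup>2 - (\<theta> i)\<^sup>2 = 2 * \<sigma> * (\<theta> i * \<xi> i) + \<sigma>\<^sup>2 * (\<xi> i)\<^sup>2"
      by (simp add: power2_eq_square algebra_simps)
    then show "(y i)\<^sup>2 * I i - (\<theta> i)\<^sup>2 = 2 * \<sigma> * (\<theta> i * \<xi> i) + \<sigma>\<^sup>2 * (\<xi> i)\<^sup>2 - (y i)\<^sup>2 * (1 - I i)"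
      by (simp add: algebra_simps)
  qed
  also have "\<dots> = 2 * \<sigma> * (\<Sum>i\<in>A. \<theta> i * \<xi> i) + \<sigma>\<^sup>2 * (\<Sum>i\<in>A. (\<xi> i)\<^sup>2) - R"
    by (simp add: sum_subtractf sum.distrib sum_distrib_left R_def)
  also have "(\<Sum>i\<in>A. \<theta> i * \<xi> i) = (\<Sum>i=1..d. \<theta> i * \<xi> i)"
    using AB by (intro sum.mono_neutral_left) (auto simp: A_def)
  finally have err: "Q_tilde d y - Q_fun d \<theta>
      = 2 * \<sigma> * (\<Sum>i=1..d. \<theta> i * \<xi> i) + \<sigma>\<^sup>2 * (\<Sum>i\<in>A. (\<xi> i)\<^sup>2) - R + Z" .
  have R0: "0 \<le> R" unfolding R_def by (intro sum_nonneg) (auto simp: I_def)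
  have R_le: "R \<le> \<sigma>\<^sup>2 * (real s * 18 * L / d) * X"
  proof -
    \<comment> \<open>A removed observation satisfies \<open>\<bar>y i\<bar> \<le> T\<close>,
      whatever the size of \<open>\<theta> i\<close>.\<close>
    have "R \<le> (\<Sum>i\<in>A. T\<^sup>2)"
      unfolding R_def using T0
      by (intro sum_mono) (auto simp: I_def not_less abs_le_square_iff[symmetric])
    also have "\<dots> = card A * T\<^sup>2" by simp
    also have "\<dots> \<le> s * (\<sigma>\<^sup>2 * (18 * L / d * X))" using cA T2 by (intro mult_mono) auto
    finally show ?thesis by (simp add: mult_ac)
  qed
  have R2: "R\<^sup>2 \<le> \<sigma> ^ 4 * (real s * 18 * L / real d)\<^sup>2 * X\<^sup>2"
    using power_mono[OF R_le R0, of 2] by (simp add: power_mult_distrib power_divide)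
  have Z0: "0 \<le> Z" unfolding Z_def by (intro sum_nonneg) (auto simp: I_def)
  define V where "V = (\<Sum>i=1..d. (\<xi> i)\<^sup>2 * indicator {sqrt (2 * L)<..} \<bar>\<xi> i\<bar>)"
  \<comment> \<open>If the noise level is underestimated, all the noise may survive and
    \<open>w \<ge> 1\<close> pays for it. Otherwise \<open>T \<ge> \<sigma> * sqrt (2 * L)\<close>,
    so survivors off the support have \<open>\<bar>\<xi> i\<bar> > sqrt (2 * L)\<close>.\<close>
  have Z2: "Z\<^sup>2 \<le> \<sigma> ^ 4 * V\<^sup>2 + \<sigma> ^ 4 * (X\<^sup>2 * w)"
  proof (cases "sigma_hat d y < \<sigma>")
    case True
    have "Z \<le> (\<Sum>i\<in>B. \<sigma>\<^sup>2 * (\<xi> i)\<^sup>2)"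
      unfolding Z_def by (intro sum_mono) (auto simp: I_def yB power_mult_distrib)
    also have "\<dots> \<le> (\<Sum>i=1..d. \<sigma>\<^sup>2 * (\<xi> i)\<^sup>2)" using AB by (intro sum_mono2) auto
    also have "\<dots> = \<sigma>\<^sup>2 * X" by (simp add: X_def sum_distrib_left)
    finally have "Z\<^sup>2 \<le> (\<sigma>\<^sup>2 * X)\<^sup>2" using Z0 by (intro power_mono)
    also have "\<dots> = \<sigma> ^ 4 * (X\<^sup>2 * 1)" by (simp add: power_mult_distrib)
    also have "\<dots> \<le> \<sigma> ^ 4 * (X\<^sup>2 * w)" using w[OF True] by (intro mult_left_mono) auto
    also have "\<dots> \<le> \<sigma> ^ 4 * V\<^sup>2 + \<sigma> ^ 4 * (X\<^sup>2 * w)" by simp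
    finally show ?thesis .
  next
    case False
    then have "\<sigma> * sqrt (2 * L) \<le> T" unfolding T_def L_def using L0 by (intro mult_right_mono) (auto simp: L_def)
    then have "Z \<le> (\<Sum>i\<in>B. \<sigma>\<^sup>2 * ((\<xi> i)\<^sup>2 * indicator {sqrt (2 * L)<..} \<bar>\<xi> i\<bar>))"
      unfolding Z_def
    proof (intro sum_mono)
      fix i assume T: "\<sigma> * sqrt (2 * L) \<le> T" and i: "i \<in> B"
      have "sqrt (2 * L) < \<bar>\<xi> i\<bar>" if "\<bar>y i\<bar> > T"
      proof -
        have "\<sigma> * sqrt (2 * L) < \<sigma> * \<bar>\<xi> i\<bar>"
          using le_less_trans[OF T that] \<sigma> by (simp add: yB[OF i] abs_mult)
        then show ?thesis using \<sigma> by simp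
      qed
      then show "(y i)\<^sup>2 * I i \<le> \<sigma>\<^sup>2 * ((\<xi> i)\<^sup>2 * indicator {sqrt (2 * L)<..} \<bar>\<xi> i\<bar>)"
        by (auto simp: I_def yB[OF i] power_mult_distrib)
    qed
    also have "\<dots> \<le> (\<Sum>i=1..d. \<sigma>\<^sup>2 * ((\<xi> i)\<^sup>2 * indicator {sqrt (2 * L)<..} \<bar>\<xi> i\<bar>))"
      using AB by (intro sum_mono2) auto
    also have "\<dots> = \<sigma>\<^sup>2 * V" unfolding V_def by (rule sum_distrib_left[symmetric])
    finally have "Z\<^sup>2 \<le> (\<sigma>\<^sup>2 * V)\<^sup>2" using Z0 by (intro power_mono)
    also have "\<dots> = \<sigma> ^ 4 * V\<^sup>2" by (simp add: power_mult_distrib)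
    also have "\<dots> \<le> \<sigma> ^ 4 * V\<^sup>2 + \<sigma> ^ 4 * (X\<^sup>2 * w)" using w0 by simp
    finally show ?thesis .
  qed
  have "(Q_tilde d y - Q_fun d \<theta>)\<^sup>2 \<le> 4 * ((2 * \<sigma> * (\<Sum>i=1..d. \<theta> i * \<xi> i))\<^sup>2
      + (\<sigma>\<^sup>2 * (\<Sum>i\<in>A. (\<xi> i)\<^sup>2))\<^sup>2 + R\<^sup>2 + Z\<^sup>2)"
    unfolding err by (rule sq_sum_four_le)
  also have "\<dots> \<le> 4 * ((2 * \<sigma> * (\<Sum>i=1..d. \<theta> i * \<xi> i))\<^sup>2 + (\<sigma>\<^sup>2 * (\<Sum>i\<in>A. (\<xi> i)\<^sup>2))\<^sup>2
      + \<sigma> ^ 4 * (real s * 18 * L / real d)\<^sup>2 * X\<^sup>2 + (\<sigma> ^ 4 * V\<^sup>2 + \<sigma> ^ 4 * (X\<^sup>2 * w)))"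
    by (intro mult_left_mono add_mono R2 Z2 order_refl) simp
  finally show ?thesis by (simp add: power_mult_distrib V_def)
qed

section \<open>The risk bound\<close>

lemma nn_integral_ennreal_add_le:
  assumes "f \<in> borel_measurable M" "g \<in> borel_measurable M" "\<And>x. 0 \<le> f x" "\<And>x. 0 \<le> g x"
    and "(\<integral>\<^sup>+x. ennreal (f x) \<partial>M) \<le> ennreal a" "(\<integral>\<^sup>+x. ennreal (g x) \<partial>M) \<le> ennreal b" "0 \<le> a" "0 \<le> b"
  shows "(\<integral>\<^sup>+x. ennreal (f x + g x) \<partial>M) \<le> ennreal (a + b)"
  using assms by (auto simp: nn_integral_add intro!: add_mono)

lemma nn_integral_ennreal_cmult_le:
  assumes "f \<in> borel_measurable M" "(\<integral>\<^sup>+x. ennreal (f x) \<partial>M) \<le> ennreal a" "0 \<le> c"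
  shows "(\<integral>\<^sup>+x. ennreal (c * f x) \<partial>M) \<le> ennreal (c * a)"
  using assms by (auto simp: nn_integral_cmult ennreal_mult' intro!: mult_left_mono)

text \<open>The ratio 5993/6050 is the bound 5993/5000 for the expected weight of one coordinate
  times the Markov factor 100/121; being below 1, it beats \<open>d\<^sup>2\<close>.\<close>

lemma quadratic_geometric_bounded: "\<exists>C>0. \<forall>d. (real d)\<^sup>2 * (5993 / 6050) ^ d \<le> C"
proof -
  have "(\<lambda>d. (real d)\<^sup>2 * (5993 / 6050) ^ d) \<longlonglongrightarrow> 0" by real_asymp
  then have "Bseq (\<lambda>d. (real d)\<^sup>2 * (5993 / 6050) ^ d)" by (intro convergent_imp_Bseq convergentI)
  then show ?thesis unfolding Bseq_def by (simp add: abs_mult)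
qed

text \<open>The error is dominated by \<open>G\<close> composed with the inverse noise map
  \<open>(y - \<theta>) / \<sigma>\<close>. The image measure is unfolded only afterwards, for this
  measurable integrand.\<close>

lemma mse_le_noise_integral:
  fixes G :: "(nat \<Rightarrow> real) \<Rightarrow> real"
  assumes \<sigma>: "\<sigma> > 0"
    and [measurable]: "G \<in> borel_measurable (\<Pi>\<^sub>M i\<in>{1..d}. borel)"
    and le: "\<And>y \<xi>. (\<And>i. i \<in> {1..d} \<Longrightarrow> y i = \<theta> i + \<sigma> * \<xi> i) \<Longrightarrow> (Q_tilde d y - Q_fun d \<theta>)\<^sup>2 \<le> G \<xi>"
  shows "mse d \<sigma> \<theta> \<le> (\<integral>\<^sup>+\<xi>. ennreal (G \<xi>) \<partial>noise_law d)"
proof -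
  let ?N = "\<Pi>\<^sub>M i\<in>{1..d}. (borel :: real measure)"
  have sets: "sets (noise_law d) = sets ?N" unfolding noise_law_def by (intro sets_PiM_cong) auto
  have T: "(\<lambda>\<xi>. \<lambda>j\<in>{1..d}. \<theta> j + \<sigma> * \<xi> j) \<in> measurable (noise_law d) ?N"
    by (subst measurable_cong_sets[OF sets refl]) measurable
  have "(\<lambda>y. \<lambda>j\<in>{1..d}. (y j - \<theta> j) / \<sigma>) \<in> measurable ?N ?N" by measurable
  then have G': "(\<lambda>y. ennreal (G (\<lambda>j\<in>{1..d}. (y j - \<theta> j) / \<sigma>))) \<in> borel_measurable ?N"
    by measurable
  have "mse d \<sigma> \<theta> \<le> (\<integral>\<^sup>+y. ennreal (G (\<lambda>j\<in>{1..d}. (y j - \<theta> j) / \<sigma>)) \<partial>obs_law d \<sigma> \<theta>)"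
    unfolding mse_def
  proof (intro nn_integral_mono ennreal_leI le)
    fix y :: "nat \<Rightarrow> real" and i assume "i \<in> {1..d}"
    then show "y i = \<theta> i + \<sigma> * (\<lambda>j\<in>{1..d}. (y j - \<theta> j) / \<sigma>) i" using \<sigma> by simp
  qed
  also have "\<dots> = (\<integral>\<^sup>+\<xi>. ennreal (G (\<lambda>j\<in>{1..d}. ((\<lambda>j\<in>{1..d}. \<theta> j + \<sigma> * \<xi> j) j - \<theta> j) / \<sigma>)) \<partial>noise_law d)"
    unfolding obs_law_def using T G' by (simp add: nn_integral_distr)
  also have "\<dots> = (\<integral>\<^sup>+\<xi>. ennreal (G \<xi>) \<partial>noise_law d)"
  proof (intro nn_integral_cong)
    fix \<xi> assume "\<xi> \<in> space (noise_law d)"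
    \<comment> \<open>Extensionality makes the recovered noise equal to \<open>\<xi>\<close> as a
      function, also outside \<open>{1..d}\<close>.\<close>
    then have "\<xi> \<in> extensional {1..d}" by (auto simp: noise_law_def space_PiM PiE_def)
    then have "(\<lambda>j\<in>{1..d}. ((\<lambda>j\<in>{1..d}. \<theta> j + \<sigma> * \<xi> j) j - \<theta> j) / \<sigma>) = \<xi>"
      using \<sigma> by (auto simp: fun_eq_iff extensional_def)
    then show "ennreal (G (\<lambda>j\<in>{1..d}. ((\<lambda>j\<in>{1..d}. \<theta> j + \<sigma> * \<xi> j) j - \<theta> j) / \<sigma>)) = ennreal (G \<xi>)" by simp
  qed
  finally show ?thesis .
qed

text \<open>The constant collects 16908 = 4 * (4 + 3 + 972 + 3248) from the linear term, the noise
  on the support, the thresholding bias and the noise surviving off it; \<open>16 * K * C\<close>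
  comes from underestimating the noise level.\<close>

lemma mse_le:
  fixes K C :: real
  assumes K: "K > 0" and weight: "\<And>d y \<sigma>. \<sigma> > 0 \<Longrightarrow> sigma_hat d y < \<sigma> \<Longrightarrow>
      1 \<le> K * (100 / 121) ^ d * (\<Prod>i=1..d. 1 + 331 / 1000 * indicator {..3 / 5} \<bar>y i / \<sigma>\<bar>)"
    and C: "\<And>d. (real d)\<^sup>2 * (5993 / 6050) ^ d \<le> C"
    and d: "d \<ge> 3" and s1: "s \<ge> 1" and s: "real s \<le> sqrt (real d)" and \<kappa>: "\<kappa> > 0" and \<sigma>: "\<sigma> > 0"
    and \<theta>: "\<theta> \<in> B2 d \<kappa> \<inter> B0 d s"
  shows "mse d \<sigma> \<theta> \<le> ennreal ((16908 + 16 * K * C) *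
    max (\<sigma>\<^sup>2 * \<kappa>\<^sup>2) (\<sigma> ^ 4 * (real s)\<^sup>2 * (ln (real d))\<^sup>2))"
proof -
  define L where "L = ln (real d)"
  define A where "A = {i \<in> {1..d}. \<theta> i \<noteq> 0}"
  define X where "X = (\<lambda>\<xi>. \<Sum>i=1..d. (\<xi> i :: real)\<^sup>2)"
  \<comment> \<open>The Markov weight in terms of the noise, as
    \<open>y i / \<sigma> = \<theta> i / \<sigma> + \<xi> i\<close>.\<close>
  define g where "g = (\<lambda>i x. 1 + 331 / 1000 * indicator {..3 / 5} \<bar>\<theta> i / \<sigma> + x\<bar> :: real)"
  define b where "b = K * (100 / 121) ^ d"
  define c where "c = \<sigma> ^ 4 * (real s * 18 * L / real d)\<^sup>2"
  define f1 where "f1 = (\<lambda>\<xi>. (\<Sum>i=1..d. \<theta> i * \<xi> i)\<^sup>2)"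
  define f2 where "f2 = (\<lambda>\<xi>. (\<Sum>i\<in>A. (\<xi> i :: real)\<^sup>2)\<^sup>2)"
  define f4 where "f4 = (\<lambda>\<xi>. (\<Sum>i=1..d. (\<xi> i)\<^sup>2 * indicator {sqrt (2 * L)<..} \<bar>\<xi> i\<bar>)\<^sup>2)"
  define f5 where "f5 = (\<lambda>\<xi>. (X \<xi>)\<^sup>2 * (\<Prod>i=1..d. g i (\<xi> i)))"
  define G where "G = (\<lambda>\<xi>. 4 * (4 * \<sigma>\<^sup>2 * f1 \<xi> + \<sigma> ^ 4 * f2 \<xi> + c * (X \<xi>)\<^sup>2
      + (\<sigma> ^ 4 * f4 \<xi> + \<sigma> ^ 4 * b * f5 \<xi>)))"
  define a where "a = 4 * (4 * \<sigma>\<^sup>2 * \<kappa>\<^sup>2 + \<sigma> ^ 4 * (3 * (real s)\<^sup>2) + c * (3 * (real d)\<^sup>2)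
      + (\<sigma> ^ 4 * (3248 * L\<^sup>2) + \<sigma> ^ 4 * b * (3 * (1331 / 1000) * (real d)\<^sup>2 * (5993 / 5000) ^ d)))"
  have L: "1 \<le> L" unfolding L_def by (rule ln_ge_one[OF d])
  have b0: "0 \<le> b" and c0: "0 \<le> c" using K by (auto simp: b_def c_def)
  have AS: "A \<subseteq> {1..d}" by (auto simp: A_def)
  have cA: "card A \<le> s" and n0: "norm0 d \<theta> \<le> s" using \<theta> by (auto simp: A_def B0_def norm0_def)
  have Q: "(\<Sum>i=1..d. (\<theta> i)\<^sup>2) \<le> \<kappa>\<^sup>2"
  proof -
    have "sqrt (Q_fun d \<theta>) \<le> \<kappa>" using \<theta> by (auto simp: B2_def norm2_def)
    then show ?thesis using \<kappa> real_sqrt_le_iff[of "Q_fun d \<theta>" "\<kappa>\<^sup>2"] by (simp add: Q_fun_def)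
  qed
  have g0: "0 \<le> g i x" and gl: "g i x \<le> 1331 / 1000" and gm: "g i \<in> borel_measurable borel" for i x
    by (auto simp: g_def indicator_def)
  \<comment> \<open>5993/5000 = 1 + (331/1000) * (3/5), with the interval probability bounded by its
    half-length 3/5.\<close>
  have gE: "(\<integral>\<^sup>+x. ennreal (g i x) \<partial>gauss) \<le> ennreal (5993 / 5000)" for i
  proof -
    have "(\<integral>\<^sup>+x. ennreal (g i x) \<partial>gauss) \<le> ennreal (1 + 331 / 1000 * (3 / 5))"
      unfolding g_def
      by (intro nn_integral_ennreal_add_le nn_integral_ennreal_cmult_le nn_integral_gauss_indicator_interval)
        (auto simp: emeasure_gauss_UNIV)
    then show ?thesis by simp
  qed
  have mf: "(\<lambda>\<xi>. \<xi> i) \<in> borel_measurable (\<Pi>\<^sub>M i\<in>{1..d}. borel)" if "i \<in> {1..d}" for i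
    using that by measurable
  have mA: "(\<lambda>\<xi>. \<xi> i) \<in> borel_measurable (\<Pi>\<^sub>M i\<in>{1..d}. borel)" if "i \<in> A" for i
    using that AS by (intro mf) auto
  note [measurable] = gm mA
  have meas: "f1 \<in> borel_measurable (\<Pi>\<^sub>M i\<in>{1..d}. borel)" "f2 \<in> borel_measurable (\<Pi>\<^sub>M i\<in>{1..d}. borel)"
      "X \<in> borel_measurable (\<Pi>\<^sub>M i\<in>{1..d}. borel)" "f4 \<in> borel_measurable (\<Pi>\<^sub>M i\<in>{1..d}. borel)"
    unfolding f1_def f2_def X_def f4_def by measurable
  moreover from this have "f5 \<in> borel_measurable (\<Pi>\<^sub>M i\<in>{1..d}. borel)"
    unfolding f5_def by measurable
  ultimately have meas_G: "G \<in> borel_measurable (\<Pi>\<^sub>M i\<in>{1..d}. borel)"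
    unfolding G_def by measurable
  have sets: "sets (noise_law d) = sets (\<Pi>\<^sub>M i\<in>{1..d}. borel)"
    unfolding noise_law_def by (intro sets_PiM_cong) auto
  note meas' [measurable] = meas[folded measurable_cong_sets[OF sets refl]]
    \<open>f5 \<in> _\<close>[folded measurable_cong_sets[OF sets refl]]
  have nn: "0 \<le> f1 \<xi>" "0 \<le> f2 \<xi>" "0 \<le> f4 \<xi>" "0 \<le> f5 \<xi>" for \<xi>
    using g0 by (auto simp: f1_def f2_def f4_def f5_def intro!: mult_nonneg_nonneg prod_nonneg)
  have "mse d \<sigma> \<theta> \<le> (\<integral>\<^sup>+\<xi>. ennreal (G \<xi>) \<partial>noise_law d)"
  proof (rule mse_le_noise_integral[OF \<sigma> meas_G])
    fix y \<xi> assume y: "y i = \<theta> i + \<sigma> * \<xi> i" if "i \<in> {1..d}" for i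
    let ?w = "b * (\<Prod>i=1..d. g i (\<xi> i))"
    have "(\<Prod>i=1..d. g i (\<xi> i)) = (\<Prod>i=1..d. 1 + 331 / 1000 * indicator {..3 / 5} \<bar>y i / \<sigma>\<bar>)"
      using \<sigma> by (intro prod.cong refl) (simp add: g_def y add_divide_distrib del: abs_divide)
    then have "1 \<le> ?w" if "sigma_hat d y < \<sigma>"
      using weight[OF \<sigma> that] by (simp add: b_def)
    moreover have "0 \<le> ?w" using g0 b0 by (intro mult_nonneg_nonneg prod_nonneg) auto
    ultimately have "(Q_tilde d y - Q_fun d \<theta>)\<^sup>2 \<le> 4 * (4 * \<sigma>\<^sup>2 * f1 \<xi> + \<sigma> ^ 4 * f2 \<xi> + c * (X \<xi>)\<^sup>2
        + (\<sigma> ^ 4 * f4 \<xi> + \<sigma> ^ 4 * ((X \<xi>)\<^sup>2 * ?w)))"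
      unfolding f1_def f2_def f4_def X_def c_def A_def L_def
      by (intro Q_tilde_error_le d s n0 \<sigma> y) auto
    also have "\<dots> = G \<xi>" by (simp add: G_def f5_def mult_ac)
    finally show "(Q_tilde d y - Q_fun d \<theta>)\<^sup>2 \<le> G \<xi>" .
  qed
  also have "\<dots> \<le> ennreal a"
  proof -
    have "(\<integral>\<^sup>+\<xi>. ennreal (f1 \<xi>) \<partial>noise_law d) \<le> ennreal (\<kappa>\<^sup>2)"
      unfolding f1_def nn_integral_noise_linear by (intro ennreal_leI Q)
    moreover have "(\<integral>\<^sup>+\<xi>. ennreal (f2 \<xi>) \<partial>noise_law d) \<le> ennreal (3 * (real s)\<^sup>2)"
      unfolding f2_def
      by (rule order_trans[OF nn_integral_noise_sq_norm[OF AS]]) (use cA in \<open>auto intro!: ennreal_leI power_mono\<close>)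
    moreover have "(\<integral>\<^sup>+\<xi>. ennreal ((X \<xi>)\<^sup>2) \<partial>noise_law d) \<le> ennreal (3 * (real d)\<^sup>2)"
      unfolding X_def using nn_integral_noise_sq_norm[of "{1..d}" d] by simp
    moreover have "(\<integral>\<^sup>+\<xi>. ennreal (f4 \<xi>) \<partial>noise_law d) \<le> ennreal (3248 * L\<^sup>2)"
      unfolding f4_def L_def by (rule nn_integral_noise_thresholded[OF d])
    moreover have "(\<integral>\<^sup>+\<xi>. ennreal (f5 \<xi>) \<partial>noise_law d)
        \<le> ennreal (3 * (1331 / 1000) * (real d)\<^sup>2 * (5993 / 5000) ^ d)"
      unfolding f5_def X_def by (intro nn_integral_noise_weighted gm g0 gl gE) simp
    ultimately show ?thesis
      unfolding G_def a_def using nn b0 c0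
      by (intro nn_integral_ennreal_add_le nn_integral_ennreal_cmult_le) (auto simp del: power_one_over)
  qed
  also have "\<dots> \<le> ennreal ((16908 + 16 * K * C) * max (\<sigma>\<^sup>2 * \<kappa>\<^sup>2) (\<sigma> ^ 4 * (real s)\<^sup>2 * L\<^sup>2))"
  proof (intro ennreal_leI)
    \<comment> \<open>As \<open>s \<ge> 1\<close> and \<open>L \<ge> 1\<close>, the terms without a
      factor \<open>s\<^sup>2\<close> or \<open>L\<^sup>2\<close> are below \<open>M\<close>
      too.\<close>
    define M where "M = max (\<sigma>\<^sup>2 * \<kappa>\<^sup>2) (\<sigma> ^ 4 * (real s)\<^sup>2 * L\<^sup>2)"
    have s2: "1 \<le> (real s)\<^sup>2" using s1 by simp
    have L2: "1 \<le> L\<^sup>2" using L by simp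
    have M1: "\<sigma>\<^sup>2 * \<kappa>\<^sup>2 \<le> M" and M2: "\<sigma> ^ 4 * (real s)\<^sup>2 * L\<^sup>2 \<le> M" by (auto simp: M_def)
    have M3: "\<sigma> ^ 4 * (real s)\<^sup>2 \<le> M"
      using mult_left_mono[OF L2, of "\<sigma> ^ 4 * (real s)\<^sup>2"] M2 by simp
    have M4: "\<sigma> ^ 4 * L\<^sup>2 \<le> M"
      using mult_left_mono[OF s2, of "\<sigma> ^ 4 * L\<^sup>2"] M2 by (simp add: mult_ac)
    have M5: "\<sigma> ^ 4 \<le> M"
      using mult_left_mono[OF s2, of "\<sigma> ^ 4"] M3 by simp
    have C0: "0 \<le> C" using C[of 0] by simp
    \<comment> \<open>The factor \<open>d\<^sup>2\<close> cancels against the \<open>1 / d\<close>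
      from averaging, and 3 * 18 * 18 = 972.\<close>
    have "c * (3 * (real d)\<^sup>2) = 972 * (\<sigma> ^ 4 * (real s)\<^sup>2 * L\<^sup>2)"
      using d by (simp add: c_def power_mult_distrib power_divide)
    then have "c * (3 * (real d)\<^sup>2) \<le> 972 * M" using M2 by linarith
    moreover have "\<sigma> ^ 4 * b * (3 * (1331 / 1000) * (real d)\<^sup>2 * (5993 / 5000) ^ d) \<le> 4 * (K * C * M)"
    proof -
      have "(100 / 121) ^ d * (5993 / 5000) ^ d = (5993 / 6050 :: real) ^ d"
        by (simp flip: power_mult_distrib)
      then have "\<sigma> ^ 4 * b * (3 * (1331 / 1000) * (real d)\<^sup>2 * (5993 / 5000) ^ d)
          = 3993 / 1000 * (K * (\<sigma> ^ 4 * ((real d)\<^sup>2 * (5993 / 6050) ^ d)))"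
        by (simp add: b_def mult_ac)
      also have "\<dots> \<le> 4 * (K * (M * C))"
        using K M5 C[of d] C0 by (intro mult_mono mult_nonneg_nonneg) (auto intro: order_trans[OF _ M5])
      finally show ?thesis by (simp add: mult_ac)
    qed
    ultimately have "a \<le> 4 * (4 * M + 3 * M + 972 * M + (3248 * M + 4 * (K * C * M)))"
      unfolding a_def using M1 M3 M4 by (intro mult_left_mono add_mono) (simp_all add: mult.assoc)
    then show "a \<le> (16908 + 16 * K * C) * M" by (simp add: algebra_simps)
  qed
  finally show ?thesis by (simp add: L_def)
qed

theorem theorem11:
  shows "\<exists>C::real. C > 0 \<and>
    (\<forall>(s::nat) (d::nat) (\<kappa>::real) (\<sigma>::real).
       s \<ge> 1 \<longrightarrow> d \<ge> 3 \<longrightarrow> real s \<le> sqrt (real d) \<longrightarrow> \<kappa> > 0 \<longrightarrow> \<sigma> > 0 \<longrightarrow>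
       (SUP \<theta>\<in>B2 d \<kappa> \<inter> B0 d s. mse d \<sigma> \<theta>)
         \<le> ennreal (C * max (\<sigma>\<^sup>2 * \<kappa>\<^sup>2) (\<sigma> ^ 4 * (real s)\<^sup>2 * (ln (real d))\<^sup>2)))"
proof -
  \<comment> \<open>\<open>K\<close> and \<open>C\<close> are fixed before dimension, sparsity,
    radius and noise level, so the final constant is absolute.\<close>
  obtain K :: real where K: "K > 0" "\<And>d y \<sigma>. \<sigma> > 0 \<Longrightarrow> sigma_hat d y < \<sigma> \<Longrightarrow>
      1 \<le> K * (100 / 121) ^ d * (\<Prod>i=1..d. 1 + 331 / 1000 * indicator {..3 / 5} \<bar>y i / \<sigma>\<bar>)"
    using sigma_hat_small_weight by metis
  obtain C :: real where C: "C > 0" "\<And>d. (real d)\<^sup>2 * (5993 / 6050) ^ d \<le> C"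
    using quadratic_geometric_bounded by metis
  have "16908 + 16 * K * C > 0" using K(1) C(1) by (simp add: add_pos_pos)
  then show ?thesis
    using mse_le[OF K C(2)] by (intro exI[of _ "16908 + 16 * K * C"]) (auto intro!: SUP_least)
qed

end
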